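(* For any $d\geq 2$ and any $n_1\geq\cdots\geq n_d\geq 1$ it holds \[\mathrm{qc}(n_1, n_2, \dots, n_d) \in O \left( \prod_{i = 2}^{d} n_i \left( \log_2 \frac{n_1}{n_{2}} + 1 \right) \right).\]
   Context: Search game on the grid $S_1\times\cdots\times S_d$ with $S_i=\{0,\ldots,n_i-1\}$: Adversary fixes a target $t$; Algorithm queries a point $q$; if $q\neq t$, Adversary answers for every coordinate $i$ one of $t_i<q_i$ or $t_i>q_i$, at least one of these $d$ inequalities being true, and Algorithm does not learn which one. $\mathrm{qc}(n_1,\ldots,n_d)$ denotes the minimum number of queries that guarantees finding the target (the query complexity). *)

theory Defs
  imports Complex_Main "HOL-Library.FuncSet" "HOL-Library.Landau_Symbols"
begin

type_synonym point = "nat \<Rightarrow> nat"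

definition grid :: "nat \<Rightarrow> (nat \<Rightarrow> nat) \<Rightarrow> point set" where
  "grid d n = (\<Pi>\<^sub>E i\<in>{1..d}. {0..<n i})"

text \<open>An answer claims, for each coordinate \<open>i\<close>, either \<open>t i < q i\<close> (\<open>Below\<close>) or \<open>t i > q i\<close>
  (\<open>Above\<close>). Its values outside \<open>{1..d}\<close> carry no claim.\<close>

datatype side = Below | Above

type_synonym answer = "nat \<Rightarrow> side"

fun claim_holds :: "side \<Rightarrow> nat \<Rightarrow> nat \<Rightarrow> bool" where
  "claim_holds Below t q \<longleftrightarrow> t < q"
| "claim_holds Above t q \<longleftrightarrow> t > q"

definition admissible :: "nat \<Rightarrow> point \<Rightarrow> point \<Rightarrow> answer \<Rightarrow> bool" where
  "admissible d t q a \<longleftrightarrow> (\<exists>i\<in>{1..d}. claim_holds (a i) (t i) (q i))"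

text \<open>A strategy of Algorithm determines the next query from the answers received so far; its own
  earlier queries are determined by these answers.\<close>

type_synonym strategy = "answer list \<Rightarrow> point"

definition is_strategy :: "nat \<Rightarrow> (nat \<Rightarrow> nat) \<Rightarrow> strategy \<Rightarrow> bool" where
  "is_strategy d n \<sigma> \<longleftrightarrow> (\<forall>h. \<sigma> h \<in> grid d n)"

definition query :: "strategy \<Rightarrow> (nat \<Rightarrow> answer) \<Rightarrow> nat \<Rightarrow> point" where
  "query \<sigma> a k = \<sigma> (map a [0..<k])"

text \<open>Whatever the target and the answers, the target is among the first \<open>m\<close> queries. Since \<open>a\<close>
  is arbitrary, Adversary may answer adaptively; answers from the query hitting the target onwards
  are irrelevant.\<close>

definition finds_within :: "nat \<Rightarrow> (nat \<Rightarrow> nat) \<Rightarrow> strategy \<Rightarrow> nat \<Rightarrow> bool" where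
  "finds_within d n \<sigma> m \<longleftrightarrow>
     (\<forall>t\<in>grid d n. \<forall>a. (\<forall>k<m. query \<sigma> a k \<noteq> t \<longrightarrow> admissible d t (query \<sigma> a k) (a k)) \<longrightarrow>
        (\<exists>k<m. query \<sigma> a k = t))"

definition qc :: "nat \<Rightarrow> (nat \<Rightarrow> nat) \<Rightarrow> nat" where
  "qc d n = (LEAST m. \<exists>\<sigma>. is_strategy d n \<sigma> \<and> finds_within d n \<sigma> m)"

text \<open>Querying all grid points one by one shows that the minimum in \<^const>\<open>qc\<close> is attained.\<close>

lemma qc_attained:
  assumes "\<And>i. i \<in> {1..d} \<Longrightarrow> n i \<ge> 1"
  shows "\<exists>\<sigma>. is_strategy d n \<sigma> \<and> finds_within d n \<sigma> (qc d n)"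
proof -
  have "finite (grid d n)"
    unfolding grid_def by (intro finite_PiE) auto
  then obtain xs where xs: "set xs = grid d n"
    using finite_list by blast
  have "grid d n \<noteq> {}"
    using assms unfolding grid_def by (force simp: PiE_eq_empty_iff)
  then have ne: "xs \<noteq> []"
    using xs by auto
  define \<sigma> :: strategy where "\<sigma> h = xs ! (length h mod length xs)" for h
  have "is_strategy d n \<sigma>"
    using ne xs unfolding is_strategy_def \<sigma>_def by (metis length_greater_0_conv mod_less_divisor nth_mem)
  moreover have "finds_within d n \<sigma> (length xs)"
    unfolding finds_within_def query_def \<sigma>_def
    using xs by (metis in_set_conv_nth length_map length_upt minus_nat.diff_0 mod_less)
  ultimately show ?thesis
    unfolding qc_def by (rule_tac LeastI[where k = "length xs"]) blast
qed

end

theory Submission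
  imports Defs
begin

text \<open>
  For a target that agrees with the query in the coordinates \<open>i \<ge> 3\<close>, one of the claims about the
  first two coordinates is true. So it suffices to search a rectangle of height \<open>n 1\<close> and width
  \<open>n 2\<close>, separately for each choice of the other coordinates.

  In a rectangle of height \<open>L\<close>, perform a binary search for the first coordinate in the middle
  column. Each answer excludes a closed quadrant, so it cuts the middle column and also the part
  on the left of it or the part on the right of it. Once the column is exhausted, the heights of
  the remaining left and right parts sum up to at most \<open>L\<close>. Recursing into the two parts, the
  concavity of the logarithm bounds the number of queries at depth \<open>j\<close>, for a rectangle of width
  below \<open>2 ^ k\<close>, by \<open>2 ^ j * (1 + (k - j) + log 2 (1 + L / 2 ^ k))\<close>; the sum over \<open>j < k\<close> is of
  order \<open>2 ^ k * (1 + log 2 (1 + L / 2 ^ k))\<close>.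
\<close>

section \<open>The game as a recursion on sets of candidates\<close>

text \<open>\<open>A\<close> consists of the targets consistent with the answers so far. It must be
  empty at the end because a candidate also leaves it by being queried.\<close>

fun win :: "nat \<Rightarrow> (nat \<Rightarrow> nat) \<Rightarrow> nat \<Rightarrow> point set \<Rightarrow> bool" where
  "win d n 0 A \<longleftrightarrow> A = {}"
| "win d n (Suc m) A \<longleftrightarrow>
     (\<exists>q\<in>grid d n. \<forall>a. win d n m {t \<in> A. t \<noteq> q \<and> admissible d t q a})"

lemma win_subset: "win d n m B \<Longrightarrow> A \<subseteq> B \<Longrightarrow> win d n m A"
proof (induction m arbitrary: A B)
  case (Suc m)
  then obtain q where "q \<in> grid d n"
    and q: "\<And>a. win d n m {t \<in> B. t \<noteq> q \<and> admissible d t q a}"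
    by auto
  moreover have "win d n m {t \<in> A. t \<noteq> q \<and> admissible d t q a}" for a
    by (rule Suc.IH[OF q]) (use Suc.prems in auto)
  ultimately show ?case by auto
qed auto

lemma win_empty: "grid d n \<noteq> {} \<Longrightarrow> win d n m {}"
  by (induction m) auto

text \<open>The queries for \<open>A\<close> come first. Their answers can only shrink
  \<open>B\<close>, so the queries for \<open>B\<close> still suffice afterwards.\<close>

lemma win_Un: "win d n m A \<Longrightarrow> win d n k B \<Longrightarrow> win d n (m + k) (A \<union> B)"
proof (induction m arbitrary: A)
  case (Suc m)
  then obtain q where q: "q \<in> grid d n"
    "\<And>a. win d n m {t \<in> A. t \<noteq> q \<and> admissible d t q a}"
    by auto
  have "win d n (m + k) {t \<in> A \<union> B. t \<noteq> q \<and> admissible d t q a}" for a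
    by (rule win_subset[OF Suc.IH[OF q(2)[of a] Suc.prems(2)]]) auto
  with q(1) show ?case by auto
qed auto

lemma win_mono:
  assumes "grid d n \<noteq> {}" "win d n m A" "m \<le> k"
  shows "win d n k A"
  using win_Un[OF assms(2) win_empty[OF assms(1), of "k - m"]] assms(3) by simp

lemma win_UN:
  assumes "grid d n \<noteq> {}" "finite P" "\<And>p. p \<in> P \<Longrightarrow> win d n m (A p)"
  shows "win d n (card P * m) (\<Union>p\<in>P. A p)"
  using assms(2,3)
  by (induction rule: finite_induct) (auto simp: win_empty[OF assms(1)] intro!: win_Un)

text \<open>The recursion unfolds into an explicit strategy: ask \<open>q\<close>, then follow a
  strategy chosen for the subgame that the first answer leaves.\<close>

lemma strategy_of_win:
  assumes "grid d n \<noteq> {}" "win d n m A"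
  shows "\<exists>\<sigma>. is_strategy d n \<sigma> \<and>
     (\<forall>t\<in>A. \<forall>a. (\<forall>k<m. query \<sigma> a k \<noteq> t \<longrightarrow> admissible d t (query \<sigma> a k) (a k)) \<longrightarrow>
        (\<exists>k<m. query \<sigma> a k = t))"
  using assms(2)
proof (induction m arbitrary: A)
  case 0
  obtain g where "g \<in> grid d n" using assms(1) by auto
  with 0 show ?case by (intro exI[of _ "\<lambda>_. g"]) (auto simp: is_strategy_def)
next
  case (Suc m)
  then obtain q where q: "q \<in> grid d n"
    "\<And>a. win d n m {t \<in> A. t \<noteq> q \<and> admissible d t q a}"
    by auto
  obtain \<tau> where \<tau>: "\<And>b. is_strategy d n (\<tau> b)"
    and found: "\<And>b t a. \<lbrakk>t \<in> A; t \<noteq> q; admissible d t q b;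
        \<forall>k<m. query (\<tau> b) a k \<noteq> t \<longrightarrow> admissible d t (query (\<tau> b) a k) (a k)\<rbrakk> \<Longrightarrow>
        \<exists>k<m. query (\<tau> b) a k = t"
    using Suc.IH[OF q(2)] by (simp only: mem_Collect_eq Ball_def) metis
  define \<sigma> where "\<sigma> h = (case h of [] \<Rightarrow> q | b # h' \<Rightarrow> \<tau> b h')" for h
  have query_0: "query \<sigma> a 0 = q" for a
    by (simp add: query_def \<sigma>_def)
  \<comment> \<open>Dropping the first answer turns the later queries into those of the
    subgame.\<close>
  have query_Suc: "query \<sigma> a (Suc k) = query (\<tau> (a 0)) (\<lambda>i. a (Suc i)) k" for a k
    unfolding query_def \<sigma>_def
    by (simp only: upt_conv_Cons[OF zero_less_Suc] map_Suc_upt[symmetric] list.map map_map)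
      (simp add: comp_def)
  have "is_strategy d n \<sigma>"
    using \<tau> q(1) by (auto simp: is_strategy_def \<sigma>_def split: list.split)
  moreover have "\<exists>k<Suc m. query \<sigma> a k = t"
    if t: "t \<in> A"
      and adm: "\<forall>k<Suc m. query \<sigma> a k \<noteq> t \<longrightarrow> admissible d t (query \<sigma> a k) (a k)" for t a
  proof (cases "t = q")
    case True
    then show ?thesis using query_0 by auto
  next
    case False
    then have "admissible d t q (a 0)"
      using adm query_0 by (metis zero_less_Suc)
    moreover have "\<forall>k<m. query (\<tau> (a 0)) (\<lambda>i. a (Suc i)) k \<noteq> t \<longrightarrow>
        admissible d t (query (\<tau> (a 0)) (\<lambda>i. a (Suc i)) k) (a (Suc k))"
      using adm query_Suc by (metis Suc_mono)
    ultimately show ?thesis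
      using found[OF t False] query_Suc by (metis Suc_mono)
  qed
  ultimately show ?case by blast
qed

lemma qc_le_if_win:
  assumes "grid d n \<noteq> {}" "win d n m (grid d n)"
  shows "qc d n \<le> m"
  using strategy_of_win[OF assms] unfolding qc_def finds_within_def by (rule Least_le)

section \<open>Exhausting one column by binary search\<close>

definition slice ::
  "nat \<Rightarrow> (nat \<Rightarrow> nat) \<Rightarrow> point \<Rightarrow> nat \<Rightarrow> nat \<Rightarrow> nat \<Rightarrow> nat \<Rightarrow> point set" where
  "slice d n p l h u v =
     {t \<in> grid d n. (\<forall>i\<in>{3..d}. t i = p i) \<and> t 1 \<in> {l..<h} \<and> t 2 \<in> {u..<v}}"

text \<open>The state while column \<open>x\<close> is searched. Its remaining heights form the
  intersection of the left and the right interval, since every cut of a side cuts the column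
  too.\<close>

definition split_slice where
  "split_slice d n p u v x aL bL aR bR =
     slice d n p aL bL u x \<union> slice d n p aR bR (Suc x) v
     \<union> slice d n p (max aL aR) (min bL bR) x (Suc x)"

lemma grid_slice_point:
  assumes "2 \<le> d" "p \<in> (\<Pi>\<^sub>E i\<in>{3..d}. {0..<n i})" "y < n 1" "x < n 2"
  shows "p(1 := y, 2 := x) \<in> grid d n"
proof -
  have "{1..d} = insert 2 (insert 1 {3..d})"
    using assms(1) by auto
  then show ?thesis
    unfolding grid_def using assms(2-4) by (auto simp: PiE_iff extensional_def)
qed

text \<open>The claims about the first two coordinates exclude one of the four closed quadrants at
  the query. This moves one endpoint of the left or the right interval, hence the four
  premises.\<close>

lemma column_query:
  assumes p: "2 \<le> d" "p \<in> (\<Pi>\<^sub>E i\<in>{3..d}. {0..<n i})" and "y < n 1" "x < n 2"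
    and y: "max aL aR \<le> y" "y < min bL bR"
    and "win d n m (split_slice d n p u v x (Suc y) bL aR bR)"
    and "win d n m (split_slice d n p u v x aL bL (Suc y) bR)"
    and "win d n m (split_slice d n p u v x aL y aR bR)"
    and "win d n m (split_slice d n p u v x aL bL aR y)"
  shows "win d n (Suc m) (split_slice d n p u v x aL bL aR bR)"
proof -
  let ?q = "p(1 := y, 2 := x)"
  let ?S = "split_slice d n p u v x"
  have "win d n m {t \<in> ?S aL bL aR bR. t \<noteq> ?q \<and> admissible d t ?q a}" (is "win d n m ?T") for a
  proof -
    have claim: "claim_holds (a 1) (t 1) y \<or> claim_holds (a 2) (t 2) x" if t: "t \<in> ?T" for t
    proof -
      obtain i where i: "i \<in> {1..d}" "claim_holds (a i) (t i) (?q i)"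
        using t by (auto simp: admissible_def)
      have "i = 1 \<or> i = 2 \<or> i \<in> {3..d}" using i(1) by auto
      \<comment> \<open>Target and query both agree with \<open>p\<close> there, and a strict claim
        about equal values is false.\<close>
      moreover have "i \<notin> {3..d}"
      proof
        assume "i \<in> {3..d}"
        moreover from this have "t i = p i"
          using t by (auto simp: split_slice_def slice_def)
        ultimately show False using i(2) by (cases "a i") auto
      qed
      ultimately show ?thesis using i(2) by auto
    qed
    have "\<exists>B. ?T \<subseteq> B \<and> win d n m B"
    proof (cases "a 1"; cases "a 2")
      assume a: "a 1 = Below" "a 2 = Below"
      have "?T \<subseteq> ?S aL bL aR y"
      proof
        fix t assume t: "t \<in> ?T"
        from claim[OF t, unfolded a claim_holds.simps] t y show "t \<in> ?S aL bL aR y"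
          by (auto simp: split_slice_def slice_def)
      qed
      then show ?thesis using assms by blast
    next
      assume a: "a 1 = Below" "a 2 = Above"
      have "?T \<subseteq> ?S aL y aR bR"
      proof
        fix t assume t: "t \<in> ?T"
        from claim[OF t, unfolded a claim_holds.simps] t y show "t \<in> ?S aL y aR bR"
          by (auto simp: split_slice_def slice_def)
      qed
      then show ?thesis using assms by blast
    next
      assume a: "a 1 = Above" "a 2 = Below"
      have "?T \<subseteq> ?S aL bL (Suc y) bR"
      proof
        fix t assume t: "t \<in> ?T"
        from claim[OF t, unfolded a claim_holds.simps] t y show "t \<in> ?S aL bL (Suc y) bR"
          by (auto simp: split_slice_def slice_def)
      qed
      then show ?thesis using assms by blast
    next
      assume a: "a 1 = Above" "a 2 = Above"
      have "?T \<subseteq> ?S (Suc y) bL aR bR"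
      proof
        fix t assume t: "t \<in> ?T"
        from claim[OF t, unfolded a claim_holds.simps] t y show "t \<in> ?S (Suc y) bL aR bR"
          by (auto simp: split_slice_def slice_def)
      qed
      then show ?thesis using assms by blast
    qed
    then show ?thesis using win_subset by blast
  qed
  then show ?thesis
    using grid_slice_point[of d p n y x] assms by auto
qed

text \<open>Each query halves the column. \<open>final\<close> takes over once the column is empty,
  that is, once the left and right intervals do not overlap.\<close>

lemma column_search:
  assumes ne: "grid d n \<noteq> {}" and p: "2 \<le> d" "p \<in> (\<Pi>\<^sub>E i\<in>{3..d}. {0..<n i})" and "h \<le> n 1" "x < n 2"
    and final: "\<And>aL bL aR bR. \<lbrakk>l \<le> aL; l \<le> aR; bL \<le> h; bR \<le> h; min bL bR \<le> max aL aR\<rbrakk> \<Longrightarrow>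
        win d n m (slice d n p aL bL u x \<union> slice d n p aR bR (Suc x) v)"
    and "l \<le> aL" "l \<le> aR" "bL \<le> h" "bR \<le> h" "min bL bR - max aL aR < 2 ^ s"
  shows "win d n (s + m) (split_slice d n p u v x aL bL aR bR)"
  using assms(7-)
proof (induction s arbitrary: aL bL aR bR)
  case 0
  then have "slice d n p (max aL aR) (min bL bR) x (Suc x) = {}"
    by (auto simp: slice_def)
  with final[of aL aR bL bR] 0 show ?case
    by (simp add: split_slice_def)
next
  case (Suc s)
  show ?case
  proof (cases "min bL bR - max aL aR = 0")
    case True
    then have "win d n (s + m) (split_slice d n p u v x aL bL aR bR)"
      by (intro Suc.IH) (use Suc.prems in auto)
    then show ?thesis using win_mono[OF ne, of "s + m"] by (simp del: win.simps)
  next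
    case False
    define a b where "a = max aL aR" and "b = min bL bR"
    note ab = a_def[symmetric] b_def[symmetric]
    \<comment> \<open>Of fewer than \<open>2 ^ Suc s\<close> heights, the midpoint leaves fewer than
      \<open>2 ^ s\<close> below it and above it.\<close>
    define y where "y = a + (b - a) div 2"
    have y: "max aL aR \<le> y" "y < min bL bR" "y - max aL aR < 2 ^ s" "min bL bR - Suc y < 2 ^ s"
      using False Suc.prems(5) unfolding ab y_def power_Suc by linarith+
    have eqs: "max (Suc y) aR = Suc y" "max aL (Suc y) = Suc y" "min y bR = y" "min bL y = y"
      using y(1,2) by auto
    show ?thesis
      unfolding add_Suc
    proof (rule column_query[OF p _ \<open>x < n 2\<close> y(1,2)])
      show "y < n 1" using y(2) Suc.prems(3) \<open>h \<le> n 1\<close> by simp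
      show "win d n (s + m) (split_slice d n p u v x (Suc y) bL aR bR)"
        by (rule Suc.IH) (use y Suc.prems eqs in simp_all)
      show "win d n (s + m) (split_slice d n p u v x aL bL (Suc y) bR)"
        by (rule Suc.IH) (use y Suc.prems eqs in simp_all)
      show "win d n (s + m) (split_slice d n p u v x aL y aR bR)"
        by (rule Suc.IH) (use y Suc.prems eqs in simp_all)
      show "win d n (s + m) (split_slice d n p u v x aL bL aR y)"
        by (rule Suc.IH) (use y Suc.prems eqs in simp_all)
    qed
  qed
qed

section \<open>The recursive inequality for the number of queries\<close>

text \<open>Concavity of the logarithm, from the inequality of arithmetic and geometric
  means.\<close>

lemma log2_avg:
  fixes x y :: real
  assumes "x > 0" "y > 0"
  shows "log 2 x + log 2 y \<le> 2 * log 2 ((x + y) / 2)"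
proof -
  have "x * y \<le> ((x + y) / 2)\<^sup>2"
    using zero_le_power2[of "x - y"] by (simp add: power2_eq_square field_simps)
  then have "log 2 (x * y) \<le> log 2 (((x + y) / 2)\<^sup>2)"
    using assms by (subst log_le_cancel_iff) auto
  then show ?thesis
    using assms by (simp add: log_mult log_nat_power)
qed

text \<open>This is \<open>\<Sum>j<k. 2 ^ j * (1 + (k - j) + log 2 (1 + L / 2 ^ k))\<close> in closed form.\<close>

definition rect_bound :: "nat \<Rightarrow> nat \<Rightarrow> real" where
  "rect_bound k L = (2 ^ k - 1) * (1 + log 2 (1 + L / 2 ^ k)) + 2 ^ Suc k - 2 - k"

lemma rect_bound_nonneg: "rect_bound k L \<ge> 0"
proof -
  have "real (Suc k) \<le> 2 ^ k"
    by (metis Suc_leI less_exp of_nat_le_iff of_nat_numeral of_nat_power)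
  then have "real k + 2 \<le> 2 ^ Suc k" by simp
  moreover have "0 \<le> (2 ^ k - 1) * (1 + log 2 (1 + L / 2 ^ k))"
    by (intro mult_nonneg_nonneg add_nonneg_nonneg zero_le_log_cancel_iff[THEN iffD2])
      (auto simp: add_pos_nonneg)
  ultimately show ?thesis unfolding rect_bound_def by linarith
qed

text \<open>One level of the recursion: \<open>i\<close> and \<open>j\<close> are the heights left
  on the two sides, and the last summand pays for the middle column.\<close>

lemma rect_bound_split:
  assumes "i + j \<le> L"
  shows "rect_bound k i + rect_bound k j + (1 + log 2 (1 + real L)) \<le> rect_bound (Suc k) L"
proof -
  define g where "g = log 2 (1 + L / 2 ^ Suc k)"
  have "log 2 (1 + i / 2 ^ k) + log 2 (1 + j / 2 ^ k)
      \<le> 2 * log 2 (((1 + i / 2 ^ k) + (1 + j / 2 ^ k)) / 2)"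
    by (rule log2_avg) (auto intro: add_pos_nonneg)
  also have "\<dots> \<le> 2 * g"
  proof -
    have "real i + real j \<le> real L" using assms by linarith
    then have "(real i + real j) / 2 ^ Suc k \<le> real L / 2 ^ Suc k"
      by (rule divide_right_mono) simp
    then have "((1 + i / 2 ^ k) + (1 + j / 2 ^ k)) / 2 \<le> 1 + L / 2 ^ Suc k"
      by (simp add: add_divide_distrib)
    moreover have "0 < ((1 + i / 2 ^ k) + (1 + j / 2 ^ k)) / 2"
      by (simp add: add_pos_nonneg)
    ultimately show ?thesis
      unfolding g_def by simp
  qed
  finally have "(2 ^ k - 1) * (log 2 (1 + i / 2 ^ k) + log 2 (1 + j / 2 ^ k)) \<le> (2 ^ k - 1) * (2 * g)"
    by (intro mult_left_mono) auto
  moreover have "log 2 (1 + real L) \<le> Suc k + g"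
  proof -
    have "log 2 (1 + real L) \<le> log 2 (2 ^ Suc k * (1 + L / 2 ^ Suc k))"
    proof (subst log_le_cancel_iff)
      have "1 \<le> (2::real) ^ Suc k" by (rule one_le_power) simp
      then show "1 + real L \<le> 2 ^ Suc k * (1 + L / 2 ^ Suc k)"
        by (simp add: distrib_left)
    qed (auto simp: add_pos_nonneg)
    also have "\<dots> = Suc k + g"
    proof -
      have "0 < 1 + L / 2 ^ Suc k" by (rule add_pos_nonneg) auto
      then show ?thesis
        unfolding g_def by (subst log_mult) (auto simp: log_nat_power simp del: power_Suc)
    qed
    finally show ?thesis .
  qed
  \<comment> \<open>Inserting the two estimates yields exactly the right-hand side.\<close>
  ultimately show ?thesis
    unfolding rect_bound_def g_def[symmetric] by (simp add: algebra_simps)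
qed

section \<open>Searching a rectangle\<close>

text \<open>By induction on \<open>k\<close>: the middle column splits a width below
  \<open>2 ^ Suc k\<close> into two widths below \<open>2 ^ k\<close>.\<close>

lemma win_slice:
  assumes p: "2 \<le> d" "p \<in> (\<Pi>\<^sub>E i\<in>{3..d}. {0..<n i})"
    and "h \<le> n 1" "v \<le> n 2" "v - u < 2 ^ k"
  shows "\<exists>m. real m \<le> rect_bound k (h - l) \<and> win d n m (slice d n p l h u v)"
  using assms(3-)
proof (induction k arbitrary: l h u v)
  case 0
  then have "slice d n p l h u v = {}" by (auto simp: slice_def)
  then show ?case using rect_bound_nonneg by (intro exI[of _ 0]) auto
next
  case (Suc k)
  show ?case
  proof (cases "l < h \<and> u < v")
    case False
    then have "slice d n p l h u v = {}" by (auto simp: slice_def)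
    then show ?thesis using rect_bound_nonneg by (intro exI[of _ 0]) auto
  next
    case True
    then have ne: "grid d n \<noteq> {}"
      using grid_slice_point[of d p n l u] p Suc.prems by auto
    define x where "x = u + (v - u) div 2"
    have x: "u \<le> x" "x < v" "x - u < 2 ^ k" "v - Suc x < 2 ^ k"
      using True Suc.prems(3) unfolding x_def power_Suc by linarith+
    \<comment> \<open>A joint budget for both sides, independent of how the answers divide the
      height between them.\<close>
    define M where "M = nat \<lfloor>rect_bound (Suc k) (h - l) - (1 + log 2 (1 + real (h - l)))\<rfloor>"
    have final: "win d n M (slice d n p aL bL u x \<union> slice d n p aR bR (Suc x) v)"
      if ab: "l \<le> aL" "l \<le> aR" "bL \<le> h" "bR \<le> h" "min bL bR \<le> max aL aR" for aL bL aR bR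
    proof -
      obtain mL where mL: "real mL \<le> rect_bound k (bL - aL)" "win d n mL (slice d n p aL bL u x)"
        using Suc.IH[of bL x u aL] ab x Suc.prems by auto
      obtain mR where mR: "real mR \<le> rect_bound k (bR - aR)"
        "win d n mR (slice d n p aR bR (Suc x) v)"
        using Suc.IH[of bR v "Suc x" aR] ab x Suc.prems by auto
      \<comment> \<open>Both intervals lie in \<open>{l..<h}\<close> and are disjoint.\<close>
      have "(bL - aL) + (bR - aR) \<le> h - l" using ab True by linarith
      from rect_bound_split[OF this, of k] mL(1) mR(1) have "mL + mR \<le> M"
        unfolding M_def by linarith
      then show ?thesis using win_mono[OF ne win_Un[OF mL(2) mR(2)]] by simp
    qed
    \<comment> \<open>\<open>Suc r\<close> halvings exhaust a column of \<open>h - l\<close>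
      heights, and \<open>r\<close> is at most the logarithm of \<open>h - l + 1\<close>.\<close>
    obtain r where r: "2 ^ r \<le> h - l + 1" "h - l + 1 < 2 ^ (r + 1)"
      using ex_power_ivl1[of 2 "h - l + 1"] by auto
    have "win d n (Suc r + M) (split_slice d n p u v x l h l h)"
      by (rule column_search[OF ne p, where l = l and h = h])
        (use final r x Suc.prems in auto)
    then have "win d n (Suc r + M) (slice d n p l h u v)"
      by (rule win_subset) (use x in \<open>auto simp: split_slice_def slice_def\<close>)
    moreover have "real (Suc r + M) \<le> rect_bound (Suc k) (h - l)"
    proof -
      have "real r \<le> log 2 (1 + real (h - l))"
        using of_nat_mono[OF r(1), where 'a = real] by (intro le_log_of_power) auto
      moreover have "real M \<le> rect_bound (Suc k) (h - l) - (1 + log 2 (1 + real (h - l)))"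
        using rect_bound_split[of 0 0 "h - l" k] rect_bound_nonneg[of k 0]
        unfolding M_def by linarith
      ultimately show ?thesis by simp
    qed
    ultimately show ?thesis by blast
  qed
qed

section \<open>From rectangles to the grid\<close>

text \<open>One rectangle is searched for each choice of the coordinates from 3 on. In the constant,
  a factor 2 comes from replacing \<open>n 2\<close> by a power of two above it, and a factor 4 from
  \<open>4 + g \<le> 4 * (g + 1)\<close>.\<close>

lemma qc_le:
  assumes d: "2 \<le> d" and anti: "antimono_on {1..d} n" and "n d \<ge> 1"
  shows "real (qc d n) \<le> 8 * ((\<Prod>i = 2..d. real (n i)) * (log 2 (real (n 1) / real (n 2)) + 1))"
proof -
  have pos: "n i \<ge> 1" if "i \<in> {1..d}" for i
    using monotone_onD[OF anti that, of d] that assms by auto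
  have n12: "n 2 \<le> n 1" "1 \<le> n 2"
    using monotone_onD[OF anti, of 1 2] pos[of 2] d by auto
  have ne: "grid d n \<noteq> {}"
    unfolding grid_def PiE_eq_empty_iff using pos by force
  let ?P = "\<Pi>\<^sub>E i\<in>{3..d}. {0..<n i}"
  obtain r where r: "2 ^ r \<le> n 2" "n 2 < 2 ^ (r + 1)"
    using ex_power_ivl1[of 2 "n 2"] n12 by auto
  define M where "M = nat \<lfloor>rect_bound (Suc r) (n 1)\<rfloor>"
  have "win d n M (slice d n p 0 (n 1) 0 (n 2))" if p: "p \<in> ?P" for p
  proof -
    obtain m where m: "real m \<le> rect_bound (Suc r) (n 1)" "win d n m (slice d n p 0 (n 1) 0 (n 2))"
      using win_slice[OF d p, of "n 1" "n 2" 0 "Suc r" 0] r by auto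
    show ?thesis
      by (rule win_mono[OF ne m(2)]) (use m(1) in \<open>unfold M_def, linarith\<close>)
  qed
  then have "win d n (card ?P * M) (\<Union>p\<in>?P. slice d n p 0 (n 1) 0 (n 2))"
    by (intro win_UN ne finite_PiE) auto
  moreover have "grid d n \<subseteq> (\<Union>p\<in>?P. slice d n p 0 (n 1) 0 (n 2))"
  proof
    fix t assume t: "t \<in> grid d n"
    then have "t i < n i" if "i \<in> {1..d}" for i
      using that by (auto simp: grid_def PiE_iff)
    then have "restrict t {3..d} \<in> ?P" "t \<in> slice d n (restrict t {3..d}) 0 (n 1) 0 (n 2)"
      using d t by (auto simp: slice_def)
    then show "t \<in> (\<Union>p\<in>?P. slice d n p 0 (n 1) 0 (n 2))" by blast
  qed
  ultimately have "qc d n \<le> card ?P * M"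
    by (intro qc_le_if_win[OF ne]) (rule win_subset)
  moreover have "card ?P = (\<Prod>i = 3..d. n i)"
    by (simp add: card_PiE)
  ultimately have qc: "real (qc d n) \<le> (\<Prod>i = 3..d. real (n i)) * real M"
    by (metis of_nat_le_iff of_nat_mult of_nat_prod)
  define g where "g = log 2 (real (n 1) / real (n 2))"
  have "g \<ge> 0" using n12 by (simp add: g_def)
  have r': "2 ^ r \<le> real (n 2)" "real (n 2) \<le> 2 ^ Suc r"
    using r by (metis of_nat_le_iff of_nat_numeral of_nat_power,
      metis Suc_eq_plus1 less_imp_le of_nat_le_iff of_nat_numeral of_nat_power)
  \<comment> \<open>The fraction is at most \<open>n 1 / n 2\<close>, which is at least 1 by
    monotonicity and so absorbs the summand 1.\<close>
  have "log 2 (1 + n 1 / 2 ^ Suc r) \<le> log 2 (2 * (real (n 1) / real (n 2)))"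
  proof (subst log_le_cancel_iff)
    have "n 1 / 2 ^ Suc r \<le> real (n 1) / real (n 2)"
      using r' n12 by (intro divide_left_mono) auto
    moreover have "1 \<le> real (n 1) / real (n 2)" using n12 by simp
    ultimately show "1 + n 1 / 2 ^ Suc r \<le> 2 * (real (n 1) / real (n 2))" by linarith
  qed (use n12 in \<open>auto simp: add_pos_nonneg\<close>)
  also have "\<dots> = 1 + g"
    unfolding g_def using n12 by (subst log_mult) auto
  finally have "log 2 (1 + n 1 / 2 ^ Suc r) \<le> 1 + g" .
  moreover have "0 \<le> log 2 (1 + n 1 / 2 ^ Suc r)"
    by (subst zero_le_log_cancel_iff) (auto simp: add_pos_nonneg)
  ultimately have "(2 ^ Suc r - 1) * (1 + log 2 (1 + n 1 / 2 ^ Suc r)) \<le> 2 ^ Suc r * (2 + g)"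
    using \<open>g \<ge> 0\<close> by (intro mult_mono) auto
  then have "rect_bound (Suc r) (n 1) \<le> 2 ^ Suc r * (4 + g)"
    unfolding rect_bound_def by (simp add: algebra_simps)
  also have "\<dots> \<le> (2 * real (n 2)) * (4 * (g + 1))"
    using r' \<open>g \<ge> 0\<close> by (intro mult_mono) auto
  finally have "real M \<le> 8 * (real (n 2) * (g + 1))"
    using rect_bound_nonneg[of "Suc r" "n 1"] unfolding M_def by linarith
  then have "(\<Prod>i = 3..d. real (n i)) * real M \<le> (\<Prod>i = 3..d. real (n i)) * (8 * (real (n 2) * (g + 1)))"
    by (intro mult_left_mono prod_nonneg) auto
  also have "\<dots> = 8 * ((\<Prod>i = 2..d. real (n i)) * (g + 1))"
    using d by (simp add: prod.atLeast_Suc_atMost numeral_3_eq_3 numeral_2_eq_2)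
  finally show ?thesis using qc unfolding g_def by linarith
qed

theorem theorem4:
  "(\<lambda>(d, n). real (qc d n))
     \<in> O[principal {(d, n). d \<ge> 2 \<and> antimono_on {1..d} n \<and> n d \<ge> 1}](\<lambda>(d, n).
         (\<Prod>i = 2..d. real (n i)) * (log 2 (real (n 1) / real (n 2)) + 1))"
\<comment> \<open>For a principal filter the bound has to hold at every pair \<open>(d, n)\<close>
  of the set; 8 works uniformly, also in \<open>d\<close>.\<close>
proof (rule bigoI[of _ 8], unfold eventually_principal, clarify)
  fix d :: nat and n :: "nat \<Rightarrow> nat"
  assume "2 \<le> d" "antimono_on {1..d} n" "1 \<le> n d"
  from qc_le[OF this] show "norm (real (qc d n)) \<le>
      8 * norm ((\<Prod>i = 2..d. real (n i)) * (log 2 (real (n 1) / real (n 2)) + 1))"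
    unfolding real_norm_def by linarith
qed

end
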